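(* Let $L/K$ be ramified with $\Delta=\pi$ as in the context, $n\ge1$ and $1\le d\le n$. Then $\{[u_\alpha\mathcal{O}_n]:\alpha\in I_d(n)\}$ is exactly the set of vertices $x$ of the Bruhat–Tits tree with $d(x,[\mathcal{O}_{n-d}])=d$ whose geodesic to $[\mathcal{O}_{n-d}]$ does not pass through $[\mathcal{O}_{n-d-1}]$.
   Context: $K$ is a nonarchimedean local field of characteristic zero with ring of integers $\mathcal{O}_K$, uniformizer $p$. $L/K$ is a ramified quadratic extension and $\pi$ a uniformizer of $L$ with minimal polynomial $X^2-\tau X+\delta$, $v_p(\tau)\ge1$, $v_p(\delta)=1$. For $m\in\mathbb{Z}$, $\mathcal{O}_m=\{x+yp^m\pi:x,y\in\mathcal{O}_K\}$. $R(p)\subset\mathcal{O}_K$ is a set of representatives of $\mathcal{O}_K/p\mathcal{O}_K$; $u^{(i)}_t=1+tp^i\pi$ for $i\ge0$, $t\in R(p)$. $I_d(n)$ is the set of tuples $\alpha=(\alpha_{n-d},\dots,\alpha_{n-1})\in R(p)^d$, and $u_\alpha=u^{(n-d)}_{\alpha_{n-d}}\cdots u^{(n-1)}_{\alpha_{n-1}}$. The Bruhat–Tits tree of $SL(2,K)$ has vertices the $K^*$-homothety classes of $\mathcal{O}_K$-lattices in $L$, adjacent iff representatives satisfy $p\Lambda\subsetneq\Lambda'\subsetneq\Lambda$. *)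

theory Defs
  imports
    "HOL-Computational_Algebra.Polynomial"
    "HOL-Library.FuncSet"
    "Graph_Theory.Shortest_Path"
begin

text \<open>Valuations are integer valued. The value at \<open>0\<close>, which is \<open>\<infinity>\<close> on paper, is left unspecified
  and never used: \<open>val_ge v x k\<close> is the reading of \<open>v x \<ge> k\<close> under that convention.\<close>

locale discrete_valuation =
  fixes v :: "'a::field \<Rightarrow> int"
  assumes val_mult: "x \<noteq> 0 \<Longrightarrow> y \<noteq> 0 \<Longrightarrow> v (x * y) = v x + v y"
    and val_add: "x \<noteq> 0 \<Longrightarrow> y \<noteq> 0 \<Longrightarrow> x + y \<noteq> 0 \<Longrightarrow> min (v x) (v y) \<le> v (x + y)"
    and val_normalized: "\<exists>x. x \<noteq> 0 \<and> v x = 1"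

definition val_ge :: "('a::field \<Rightarrow> int) \<Rightarrow> 'a \<Rightarrow> int \<Rightarrow> bool" where
  "val_ge v x k \<longleftrightarrow> x = 0 \<or> k \<le> v x"

definition uniformizer :: "('a::field \<Rightarrow> int) \<Rightarrow> 'a \<Rightarrow> bool" where
  "uniformizer v x \<longleftrightarrow> x \<noteq> 0 \<and> v x = 1"

definition val_ring :: "('a::field \<Rightarrow> int) \<Rightarrow> 'a set" where
  "val_ring v = {x. val_ge v x 0}"

definition residue_rel :: "('a::field \<Rightarrow> int) \<Rightarrow> 'a rel" where
  "residue_rel v = {(x, y). x \<in> val_ring v \<and> y \<in> val_ring v \<and> val_ge v (x - y) 1}"

locale local_field = discrete_valuation v for v :: "'k::field \<Rightarrow> int" +
  assumes complete:
    "(\<And>N. \<exists>M. \<forall>i\<ge>M. \<forall>j\<ge>M. val_ge v (X i - X j) N) \<Longrightarrow>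
      \<exists>a. \<forall>N. \<exists>M. \<forall>i\<ge>M. val_ge v (X (i::nat) - a) N"
    and finite_residue_field: "finite (val_ring v // residue_rel v)"

definition residue_reps :: "('k::field \<Rightarrow> int) \<Rightarrow> 'k \<Rightarrow> 'k set \<Rightarrow> bool" where
  "residue_reps v p R \<longleftrightarrow> R \<subseteq> val_ring v \<and>
     (\<forall>x\<in>val_ring v. \<exists>!r. r \<in> R \<and> x - r \<in> (\<lambda>z. p * z) ` val_ring v)"

text \<open>An extension \<open>L/K\<close> is given by the embedding \<open>\<iota>\<close> of the type \<open>'k\<close> into the type \<open>'l\<close>.\<close>

locale field_embedding =
  fixes \<iota> :: "'k::field \<Rightarrow> 'l::field"
  assumes emb_one: "\<iota> 1 = 1"
    and emb_add: "\<iota> (x + y) = \<iota> x + \<iota> y"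
    and emb_mult: "\<iota> (x * y) = \<iota> x * \<iota> y"

definition ext_scale :: "('k::field \<Rightarrow> 'l::field) \<Rightarrow> 'k \<Rightarrow> 'l \<Rightarrow> 'l" where
  "ext_scale \<iota> a x = \<iota> a * x"

lemma (in field_embedding) vector_space_ext_scale: "vector_space (ext_scale \<iota>)"
  by unfold_locales
    (simp_all add: ext_scale_def emb_one emb_add emb_mult algebra_simps)

text \<open>\<open>w\<close> is the normalized valuation of \<open>L\<close>; \<open>e\<close> below is the ramification index of \<open>L/K\<close>.\<close>

locale ramified_quadratic = field_embedding \<iota> + discrete_valuation w
  for v :: "'k::field \<Rightarrow> int" and w :: "'l::field \<Rightarrow> int" and \<iota> :: "'k \<Rightarrow> 'l" +
  assumes degree_two: "vector_space.dim (ext_scale \<iota>) UNIV = 2"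
    and ramified: "\<exists>e>1. \<forall>x. x \<noteq> 0 \<longrightarrow> w (\<iota> x) = e * v x"

definition minimal_poly :: "('k::field \<Rightarrow> 'l::field) \<Rightarrow> 'l \<Rightarrow> 'k poly \<Rightarrow> bool" where
  "minimal_poly \<iota> x q \<longleftrightarrow> lead_coeff q = 1 \<and> poly (map_poly \<iota> q) x = 0 \<and>
     (\<forall>r. r \<noteq> 0 \<and> poly (map_poly \<iota> r) x = 0 \<longrightarrow> degree q \<le> degree r)"

definition lattice_of :: "('k::field \<Rightarrow> int) \<Rightarrow> ('k \<Rightarrow> 'l::field) \<Rightarrow> 'l set \<Rightarrow> 'l set" where
  "lattice_of v \<iota> S = {\<Sum>s\<in>S. ext_scale \<iota> (c s) s | c. \<forall>s\<in>S. c s \<in> val_ring v}"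

text \<open>Finitely generated \<open>\<O>\<^sub>K\<close>-submodules of \<open>L\<close> that generate \<open>L\<close> over \<open>K\<close>.\<close>

definition is_lattice :: "('k::field \<Rightarrow> int) \<Rightarrow> ('k \<Rightarrow> 'l::field) \<Rightarrow> 'l set \<Rightarrow> bool" where
  "is_lattice v \<iota> \<Lambda> \<longleftrightarrow>
     (\<exists>S. finite S \<and> \<Lambda> = lattice_of v \<iota> S) \<and> module.span (ext_scale \<iota>) \<Lambda> = UNIV"

definition homothety_class :: "('k::field \<Rightarrow> 'l::field) \<Rightarrow> 'l set \<Rightarrow> 'l set set" where
  "homothety_class \<iota> \<Lambda> = {ext_scale \<iota> c ` \<Lambda> | c. c \<noteq> 0}"

definition bt_vertices :: "('k::field \<Rightarrow> int) \<Rightarrow> ('k \<Rightarrow> 'l::field) \<Rightarrow> 'l set set set" where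
  "bt_vertices v \<iota> = homothety_class \<iota> ` {\<Lambda>. is_lattice v \<iota> \<Lambda>}"

definition bt_adjacent :: "('k::field \<Rightarrow> 'l::field) \<Rightarrow> 'k \<Rightarrow> 'l set set \<Rightarrow> 'l set set \<Rightarrow> bool" where
  "bt_adjacent \<iota> p x y \<longleftrightarrow> (\<exists>\<Lambda>\<in>x. \<exists>\<Lambda>'\<in>y. ext_scale \<iota> p ` \<Lambda> \<subset> \<Lambda>' \<and> \<Lambda>' \<subset> \<Lambda>)"

text \<open>An undirected edge is represented by its two arcs: \<open>bt_adjacent\<close> is symmetric on vertices, since
  \<open>p\<Lambda> \<subset> \<Lambda>' \<subset> \<Lambda>\<close> gives \<open>p\<Lambda>' \<subset> p\<Lambda> \<subset> \<Lambda>'\<close>.\<close>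

definition bt_tree ::
  "('k::field \<Rightarrow> int) \<Rightarrow> ('k \<Rightarrow> 'l::field) \<Rightarrow> 'k \<Rightarrow> ('l set set, 'l set set \<times> 'l set set) pre_digraph" where
  "bt_tree v \<iota> p =
     \<lparr> verts = bt_vertices v \<iota>,
       arcs = {(x, y). x \<in> bt_vertices v \<iota> \<and> y \<in> bt_vertices v \<iota> \<and> bt_adjacent \<iota> p x y},
       tail = fst, head = snd \<rparr>"

lemma wf_digraph_bt_tree: "wf_digraph (bt_tree v \<iota> p)"
  by unfold_locales (auto simp: bt_tree_def)

definition graph_dist :: "('a, 'b) pre_digraph \<Rightarrow> 'a \<Rightarrow> 'a \<Rightarrow> ereal" where
  "graph_dist G x y = wf_digraph.\<mu> G (\<lambda>_. 1) x y"

text \<open>Meaningful when there is exactly one shortest walk, as in a tree.\<close>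

definition geodesic :: "('a, 'b) pre_digraph \<Rightarrow> 'a \<Rightarrow> 'a \<Rightarrow> 'b awalk" where
  "geodesic G x y =
     (THE \<gamma>. pre_digraph.awalk G x \<gamma> y \<and> ereal (real (length \<gamma>)) = graph_dist G x y)"

definition geodesic_verts :: "('a, 'b) pre_digraph \<Rightarrow> 'a \<Rightarrow> 'a \<Rightarrow> 'a set" where
  "geodesic_verts G x y = set (pre_digraph.awalk_verts G x (geodesic G x y))"

definition ring_O ::
  "('k::field \<Rightarrow> int) \<Rightarrow> ('k \<Rightarrow> 'l::field) \<Rightarrow> 'k \<Rightarrow> 'l \<Rightarrow> int \<Rightarrow> 'l set" where
  "ring_O v \<iota> p \<pi> m = {\<iota> x + \<iota> y * \<iota> p powi m * \<pi> | x y. x \<in> val_ring v \<and> y \<in> val_ring v}"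

definition unit_u :: "('k::field \<Rightarrow> 'l::field) \<Rightarrow> 'k \<Rightarrow> 'l \<Rightarrow> nat \<Rightarrow> 'k \<Rightarrow> 'l" where
  "unit_u \<iota> p \<pi> i t = 1 + \<iota> t * \<iota> p ^ i * \<pi>"

text \<open>Tuples \<open>(\<alpha>\<^bsub>n-d\<^esub>, \<dots>, \<alpha>\<^bsub>n-1\<^esub>)\<close>; used only for \<open>d \<le> n\<close>.\<close>

definition index_I :: "'k set \<Rightarrow> nat \<Rightarrow> nat \<Rightarrow> (nat \<Rightarrow> 'k) set" where
  "index_I R d n = {n - d..<n} \<rightarrow>\<^sub>E R"

definition u_prod ::
  "('k::field \<Rightarrow> 'l::field) \<Rightarrow> 'k \<Rightarrow> 'l \<Rightarrow> nat \<Rightarrow> nat \<Rightarrow> (nat \<Rightarrow> 'k) \<Rightarrow> 'l" where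
  "u_prod \<iota> p \<pi> d n \<alpha> = (\<Prod>i\<in>{n - d..<n}. unit_u \<iota> p \<pi> i (\<alpha> i))"

end

theory Submission
  imports Defs
begin

text \<open>Every homothety class of lattices contains a lattice with basis \<open>1 + a\<pi>, p\<^sup>k\<pi>\<close>, and this class
  determines and is determined by \<open>k\<close> and \<open>a\<close> modulo \<open>p\<^sup>k\<close>. So the vertices are the balls
  \<open>a + p\<^sup>k\<O>\<^sub>K\<close> of \<open>K\<close>, two of them being adjacent iff one is the ball \<open>a + p\<^bsup>k-1\<^esup>\<O>\<^sub>K\<close> just above
  the other one, \<open>a + p\<^sup>k\<O>\<^sub>K\<close>. Since \<open>[\<O>\<^sub>m]\<close> is the ball \<open>p\<^sup>m\<O>\<^sub>K\<close>, the right hand side of the theorem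
  consists of the balls of radius \<open>p\<^sup>n\<close> contained in \<open>p\<^bsup>n-d\<^esup>\<O>\<^sub>K\<close>. On the other hand, for \<open>x\<close> a unit
  and \<open>y\<close> integral, \<open>[(x + y\<pi>)\<O>\<^sub>n]\<close> is the ball of radius \<open>p\<^sup>n\<close> around \<open>y/x\<close>. Multiplication by
  \<open>1 + tp\<^sup>i\<pi>\<close> adds \<open>tp\<^sup>i\<close> to \<open>y/x\<close> modulo \<open>p\<^bsup>i+1\<^esup>\<close>, so the digits \<open>\<alpha>\<^sub>i\<close> can be chosen successively to
  reach every element of \<open>p\<^bsup>n-d\<^esup>\<O>\<^sub>K\<close> modulo \<open>p\<^sup>n\<close>.\<close>

section \<open>Trees with a distinguished end\<close>

lemma graph_dist_eq_nat_iff: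
  assumes "wf_digraph G"
  shows "graph_dist G x y = ereal (real d) \<longleftrightarrow>
    (\<exists>q. pre_digraph.awalk G x q y \<and> length q = d) \<and>
    (\<forall>q. pre_digraph.awalk G x q y \<longrightarrow> d \<le> length q)"
    (is "?L \<longleftrightarrow> ?R")
proof -
  interpret wf_digraph G by fact
  have cost: "awalk_cost (\<lambda>_. 1) q = real (length q)" for q
    by (induction q) auto
  have eq: "graph_dist G x y = (INF q\<in>{q. awalk x q y}. ereal (real (length q)))"
    by (simp add: graph_dist_def \<mu>_def cost)
  have attained: "graph_dist G x y = ereal (real d)"
    if "awalk x q y" "length q = d" "\<forall>q. awalk x q y \<longrightarrow> d \<le> length q" for q d
    unfolding eq
  proof (rule antisym)
    show "(INF q\<in>{q. awalk x q y}. ereal (real (length q))) \<le> ereal (real d)"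
      using that by (intro INF_lower2[of q]) auto
    show "ereal (real d) \<le> (INF q\<in>{q. awalk x q y}. ereal (real (length q)))"
      using that by (intro INF_greatest) auto
  qed
  show ?thesis
  proof
    assume L: ?L
    have "\<exists>q. awalk x q y"
    proof (rule ccontr)
      assume "\<nexists>q. awalk x q y"
      then have "graph_dist G x y = \<infinity>"
        unfolding eq by (simp add: top_ereal_def)
      with L show False by simp
    qed
    then obtain q where q: "awalk x q y" "\<forall>r. awalk x r y \<longrightarrow> length q \<le> length r"
      using ex_has_least_nat[of "\<lambda>q. awalk x q y" _ length] by blast
    from attained[OF q(1) refl q(2)] L have "length q = d" by simp
    with q show ?R by blast
  next
    assume ?R
    then show ?L using attained by blast
  qed
qed

text \<open>A tree seen from one of its ends: every vertex has one neighbour \<open>P x\<close> in the direction of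
  that end, and \<open>h\<close> is a Busemann function.\<close>

locale end_rooted_tree = wf_digraph G for G :: "('a, 'a \<times> 'a) pre_digraph" +
  fixes P :: "'a \<Rightarrow> 'a" and h :: "'a \<Rightarrow> int"
  assumes tail_fst: "tail G = fst" and head_snd: "head G = snd"
    and arcs_iff: "x \<in> verts G \<Longrightarrow> y \<in> verts G \<Longrightarrow> (x, y) \<in> arcs G \<longleftrightarrow> y = P x \<or> x = P y"
    and parent_vert: "x \<in> verts G \<Longrightarrow> P x \<in> verts G"
    and height_parent: "x \<in> verts G \<Longrightarrow> h (P x) = h x - 1"
begin

lemma arc_cases:
  assumes "a \<in> arcs G"
  obtains x y where "a = (x, y)" "x \<in> verts G" "y \<in> verts G" "y = P x \<or> x = P y"
proof -
  obtain x y where a: "a = (x, y)" by (cases a)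
  have "x \<in> verts G" "y \<in> verts G"
    using tail_in_verts[OF assms] head_in_verts[OF assms] by (simp_all add: a tail_fst head_snd)
  with assms a arcs_iff that show ?thesis by blast
qed

lemma awalk_Cons_cases:
  assumes "awalk x (a # q) y"
  obtains z where "a = (x, z)" "x \<in> verts G" "z \<in> verts G" "z = P x \<or> x = P z" "awalk z q y"
  using assms by (auto simp: awalk_Cons_iff tail_fst head_snd elim!: arc_cases)

lemma funpow_parent_vert: "x \<in> verts G \<Longrightarrow> (P ^^ i) x \<in> verts G"
  by (induction i) (auto simp: parent_vert)

lemma height_funpow_parent: "x \<in> verts G \<Longrightarrow> h ((P ^^ i) x) = h x - int i"
  by (induction i) (auto simp: height_parent funpow_parent_vert)

primrec ascent :: "'a \<Rightarrow> nat \<Rightarrow> ('a \<times> 'a) list" where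
  "ascent x 0 = []"
| "ascent x (Suc d) = (x, P x) # ascent (P x) d"

lemma length_ascent [simp]: "length (ascent x d) = d"
  by (induction d arbitrary: x) auto

lemma awalk_ascent: "x \<in> verts G \<Longrightarrow> awalk x (ascent x d) ((P ^^ d) x)"
  by (induction d arbitrary: x)
    (auto simp: awalk_Nil_iff awalk_Cons_iff tail_fst head_snd arcs_iff parent_vert funpow_Suc_right
      simp del: funpow.simps(2))

lemma awalk_verts_ascent: "set (awalk_verts x (ascent x d)) = (\<lambda>i. (P ^^ i) x) ` {..d}"
proof (induction d arbitrary: x)
  case (Suc d)
  have "{..Suc d} = insert 0 (Suc ` {..d})" by (rule atMost_Suc_eq_insert_0)
  then show ?case
    using Suc[of "P x"]
    by (simp add: tail_fst head_snd image_image funpow_Suc_right del: funpow.simps(2))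
qed simp

lemma awalk_height_le: "awalk x q y \<Longrightarrow> h x - h y \<le> int (length q)"
proof (induction q arbitrary: x)
  case (Cons a q)
  from Cons.prems obtain z where z: "x \<in> verts G" "z \<in> verts G" "z = P x \<or> x = P z" "awalk z q y"
    by (rule awalk_Cons_cases)
  from Cons.IH[OF z(4)] z(1-3) show ?case by (auto simp: height_parent)
qed (auto simp: awalk_Nil_iff)

lemma awalk_eq_ascent:
  "awalk x q y \<Longrightarrow> h x - h y = int (length q) \<Longrightarrow> q = ascent x (length q) \<and> y = (P ^^ length q) x"
proof (induction q arbitrary: x)
  case (Cons a q)
  from Cons.prems(1) obtain z where z: "a = (x, z)" "x \<in> verts G" "z \<in> verts G"
      "z = P x \<or> x = P z" "awalk z q y"
    by (rule awalk_Cons_cases)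
  have "x \<noteq> P z"
    using awalk_height_le[OF z(5)] Cons.prems(2) z(3) by (auto simp: height_parent)
  with z(4) have zP: "z = P x" by blast
  then have "h z - h y = int (length q)" using Cons.prems(2) z(2) by (simp add: height_parent)
  from Cons.IH[OF z(5) this] z(1) zP show ?case
    by (simp add: funpow_Suc_right del: funpow.simps(2))
qed (auto simp: awalk_Nil_iff)

lemma awalk_through_parent:
  "awalk x q y \<Longrightarrow> \<nexists>i. (P ^^ i) x = y \<Longrightarrow> P y \<in> set (awalk_verts x q)"
proof (induction q arbitrary: x)
  case Nil
  then show ?case by (metis awalk_Nil_iff funpow_0)
next
  case (Cons a q)
  from Cons.prems(1) obtain z where z: "a = (x, z)" "z = P x \<or> x = P z" "awalk z q y"
    by (rule awalk_Cons_cases)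
  show ?case
  proof (cases "\<exists>i. (P ^^ i) z = y")
    case True
    then obtain i where i: "(P ^^ i) z = y" ..
    have "z \<noteq> P x"
    proof
      assume "z = P x"
      with i have "(P ^^ Suc i) x = y" by (simp add: funpow_Suc_right del: funpow.simps(2))
      with Cons.prems(2) show False by blast
    qed
    with z(2) have xz: "x = P z" by blast
    have "i = 0"
    proof (cases i)
      case (Suc j)
      with i xz have "(P ^^ j) x = y" by (simp add: funpow_Suc_right del: funpow.simps(2))
      with Cons.prems(2) show ?thesis by blast
    qed
    with i xz show ?thesis by (simp add: z(1) tail_fst)
  next
    case False
    from Cons.IH[OF z(3) False] show ?thesis by (simp add: z(1) head_snd)
  qed
qed

definition shortest_awalk :: "'a \<Rightarrow> ('a \<times> 'a) list \<Rightarrow> 'a \<Rightarrow> bool" where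
  "shortest_awalk x q y \<longleftrightarrow> awalk x q y \<and> (\<forall>r. awalk x r y \<longrightarrow> length q \<le> length r)"

lemma shortest_awalk_to_ancestor:
  assumes "x \<in> verts G"
  shows "shortest_awalk x q ((P ^^ i) x) \<longleftrightarrow> q = ascent x i"
proof
  assume q: "shortest_awalk x q ((P ^^ i) x)"
  then have "length q \<le> i"
    using awalk_ascent[OF assms, of i] by (auto simp: shortest_awalk_def)
  moreover have "int i \<le> int (length q)"
    using awalk_height_le[of x q "(P ^^ i) x"] q height_funpow_parent[OF assms, of i]
    by (simp add: shortest_awalk_def)
  ultimately have "length q = i" by simp
  with q awalk_eq_ascent[of x q "(P ^^ i) x"] height_funpow_parent[OF assms, of i]
  show "q = ascent x i" by (simp add: shortest_awalk_def)
next
  assume q: "q = ascent x i"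
  have "i \<le> length r" if "awalk x r ((P ^^ i) x)" for r
    using awalk_height_le[OF that] height_funpow_parent[OF assms, of i] by simp
  with q awalk_ascent[OF assms] show "shortest_awalk x q ((P ^^ i) x)"
    by (simp add: shortest_awalk_def)
qed

lemma shortest_awalk_via_parent:
  assumes q: "shortest_awalk x q y" and nd: "\<nexists>i. (P ^^ i) x = y"
  obtains r where "q = r @ [(P y, y)]" "shortest_awalk x r (P y)"
proof -
  from q have aq: "awalk x q y" by (simp add: shortest_awalk_def)
  then have yv: "y \<in> verts G" by blast
  then have arc: "awalk (P y) [(P y, y)] y"
    by (simp add: awalk_Cons_iff awalk_Nil_iff tail_fst head_snd arcs_iff parent_vert)
  have "P y \<noteq> y" using height_parent[OF yv] by auto
  from awalk_through_parent[OF aq nd] obtain r s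
    where rs: "q = r @ s" "awalk x r (P y)" "awalk (P y) s y"
    using awalk_decomp[OF aq] by blast
  have min: "length r + length s \<le> length r' + 1" if "awalk x r' (P y)" for r'
  proof -
    have "length q \<le> length (r' @ [(P y, y)])"
      using q awalk_appendI[OF that arc] unfolding shortest_awalk_def by blast
    then show ?thesis using rs(1) by simp
  qed
  from min[OF rs(2)] have "length s \<le> 1" by simp
  moreover have "s \<noteq> []" using rs(3) \<open>P y \<noteq> y\<close> by (auto simp: awalk_Nil_iff)
  ultimately obtain a where s: "s = [a]" by (cases s) auto
  with rs(3) have "s = [(P y, y)]"
    by (simp add: awalk_Cons_iff awalk_Nil_iff tail_fst head_snd prod_eq_iff)
  moreover have "shortest_awalk x r (P y)"
    using rs(2) min s by (auto simp: shortest_awalk_def)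
  ultimately show ?thesis using rs(1) that by blast
qed

lemma shortest_awalk_unique:
  "shortest_awalk x q y \<Longrightarrow> shortest_awalk x q' y \<Longrightarrow> q = q'"
proof (induction "length q" arbitrary: q q' y rule: less_induct)
  case less
  show ?case
  proof (cases "\<exists>i. (P ^^ i) x = y")
    case True
    then obtain i where i: "y = (P ^^ i) x" by blast
    have x: "x \<in> verts G" using less.prems(1) by (auto simp: shortest_awalk_def)
    from less.prems i have "q = ascent x i" "q' = ascent x i"
      by (simp_all add: shortest_awalk_to_ancestor[OF x])
    then show ?thesis by simp
  next
    case False
    obtain r where r: "q = r @ [(P y, y)]" "shortest_awalk x r (P y)"
      using shortest_awalk_via_parent[OF less.prems(1) False] .
    obtain r' where r': "q' = r' @ [(P y, y)]" "shortest_awalk x r' (P y)"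
      using shortest_awalk_via_parent[OF less.prems(2) False] .
    have "r = r'" using less.hyps[OF _ r(2) r'(2)] r(1) by simp
    with r r' show ?thesis by simp
  qed
qed

lemma graph_dist_shortest_awalk:
  "shortest_awalk x q y \<Longrightarrow> graph_dist G x y = ereal (real (length q))"
  using graph_dist_eq_nat_iff[OF wf_digraph_axioms] by (auto simp: shortest_awalk_def)

lemma geodesic_eq:
  assumes "shortest_awalk x q y"
  shows "geodesic G x y = q"
proof -
  have "awalk x r y \<and> ereal (real (length r)) = graph_dist G x y \<longleftrightarrow> r = q" for r
  proof
    assume r: "awalk x r y \<and> ereal (real (length r)) = graph_dist G x y"
    with graph_dist_shortest_awalk[OF assms] have "length r = length q" by simp
    with r assms have "shortest_awalk x r y" by (simp add: shortest_awalk_def)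
    with assms show "r = q" using shortest_awalk_unique by blast
  qed (use assms graph_dist_shortest_awalk[OF assms] in \<open>auto simp: shortest_awalk_def\<close>)
  then show ?thesis by (simp add: geodesic_def)
qed

proposition descendants_eq_geodesics_avoiding_parent:
  assumes y: "y \<in> verts G"
  shows "{x \<in> verts G. graph_dist G x y = ereal (real d) \<and> P y \<notin> geodesic_verts G x y}
       = {x \<in> verts G. (P ^^ d) x = y}"
proof (intro Collect_cong conj_cong refl iffI)
  fix x assume x: "x \<in> verts G" and "(P ^^ d) x = y"
  then have s: "shortest_awalk x (ascent x d) y" using shortest_awalk_to_ancestor by blast
  have "(P ^^ i) x \<noteq> P y" if "i \<le> d" for i
  proof
    assume "(P ^^ i) x = P y"
    then have "h ((P ^^ i) x) = h y - 1" using height_parent[OF y] by simp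
    moreover have "h y = h x - int d" using \<open>(P ^^ d) x = y\<close> height_funpow_parent[OF x] by blast
    ultimately show False using height_funpow_parent[OF x] that by simp
  qed
  then have "P y \<notin> geodesic_verts G x y"
    unfolding geodesic_verts_def geodesic_eq[OF s] awalk_verts_ascent by fastforce
  with graph_dist_shortest_awalk[OF s]
  show "graph_dist G x y = ereal (real d) \<and> P y \<notin> geodesic_verts G x y" by simp
next
  fix x assume x: "x \<in> verts G"
    and *: "graph_dist G x y = ereal (real d) \<and> P y \<notin> geodesic_verts G x y"
  then obtain q where q: "shortest_awalk x q y" "length q = d"
    using graph_dist_eq_nat_iff[OF wf_digraph_axioms] by (auto simp: shortest_awalk_def)
  then have "P y \<notin> set (awalk_verts x q)"
    using * by (simp add: geodesic_verts_def geodesic_eq)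
  moreover have "awalk x q y" using q(1) by (simp add: shortest_awalk_def)
  ultimately obtain i where i: "(P ^^ i) x = y"
    using awalk_through_parent by blast
  with q have "q = ascent x i" using shortest_awalk_to_ancestor[OF x] by blast
  with i q(2) show "(P ^^ d) x = y" by simp
qed

end

section \<open>Discrete valuations\<close>

context discrete_valuation
begin

lemma val_one [simp]: "v 1 = 0"
  using val_mult[of 1 1] by simp

lemma val_neg_one [simp]: "v (- 1) = 0"
  using val_mult[of "- 1" "- 1"] by simp

lemma val_minus [simp]: "v (- x) = v x"
  using val_mult[of "- 1" x] by (cases "x = 0") auto

lemma val_inverse: "x \<noteq> 0 \<Longrightarrow> v (inverse x) = - v x"
  using val_mult[of x "inverse x"] by simp

lemma val_divide: "x \<noteq> 0 \<Longrightarrow> y \<noteq> 0 \<Longrightarrow> v (x / y) = v x - v y"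
  by (simp add: divide_inverse val_mult val_inverse)

lemma val_power: "x \<noteq> 0 \<Longrightarrow> v (x ^ i) = int i * v x"
  by (induction i) (auto simp: val_mult algebra_simps)

lemma val_power_int: "x \<noteq> 0 \<Longrightarrow> v (x powi k) = k * v x"
  by (cases k) (auto simp: power_int_def val_power val_inverse algebra_simps)

lemma val_ge_zero [simp]: "val_ge v 0 k"
  by (simp add: val_ge_def)

lemma val_ge_iff: "x \<noteq> 0 \<Longrightarrow> val_ge v x k \<longleftrightarrow> k \<le> v x"
  by (simp add: val_ge_def)

lemma val_ge_mono: "val_ge v x k \<Longrightarrow> l \<le> k \<Longrightarrow> val_ge v x l"
  by (auto simp: val_ge_def)

lemma val_ge_add: "val_ge v x k \<Longrightarrow> val_ge v y k \<Longrightarrow> val_ge v (x + y) k"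
  using val_add[of x y] by (fastforce simp: val_ge_def)

lemma val_ge_minus [simp]: "val_ge v (- x) k \<longleftrightarrow> val_ge v x k"
  by (simp add: val_ge_def)

lemma val_ge_diff: "val_ge v x k \<Longrightarrow> val_ge v y k \<Longrightarrow> val_ge v (x - y) k"
  using val_ge_add[of x k "- y"] by simp

lemma val_ge_commute: "val_ge v (x - y) k \<longleftrightarrow> val_ge v (y - x) k"
  using val_ge_minus[of "x - y"] by simp

lemma val_ge_trans: "val_ge v (x - y) k \<Longrightarrow> val_ge v (y - z) k \<Longrightarrow> val_ge v (x - z) k"
  using val_ge_add[of "x - y" k "y - z"] by simp

lemma val_ge_mult: "val_ge v x k \<Longrightarrow> val_ge v y l \<Longrightarrow> val_ge v (x * y) (k + l)"
  by (cases "x = 0"; cases "y = 0") (auto simp: val_ge_def val_mult)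

lemma val_ge_mult_iff: "x \<noteq> 0 \<Longrightarrow> val_ge v (x * y) k \<longleftrightarrow> val_ge v y (k - v x)"
  by (cases "y = 0") (auto simp: val_ge_def val_mult)

lemma val_ge_divide_iff: "y \<noteq> 0 \<Longrightarrow> val_ge v (x / y) k \<longleftrightarrow> val_ge v x (k + v y)"
  by (cases "x = 0") (auto simp: val_ge_def val_divide)

lemma val_one_plus:
  assumes "val_ge v z 1"
  shows "1 + z \<noteq> 0" "v (1 + z) = 0"
proof -
  have not1: "\<not> val_ge v 1 1" by (simp add: val_ge_def)
  have "\<not> val_ge v (1 + z) 1"
  proof
    assume "val_ge v (1 + z) 1"
    from val_ge_diff[OF this assms] not1 show False by simp
  qed
  moreover have "val_ge v (1 + z) 0"
    by (rule val_ge_add) (use assms in \<open>auto simp: val_ge_def\<close>)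
  ultimately show "1 + z \<noteq> 0" "v (1 + z) = 0" by (auto simp: val_ge_def)
qed

end

section \<open>Lattices in a quadratic extension\<close>

locale quadratic_extension = discrete_valuation v + field_embedding \<iota>
  for v :: "'k::field \<Rightarrow> int" and \<iota> :: "'k \<Rightarrow> 'l::field" +
  fixes p \<tau> \<delta> :: 'k and \<pi> :: 'l
  assumes uniformizer: "uniformizer v p"
    and dim_two: "vector_space.dim (ext_scale \<iota>) UNIV = 2"
    and minimal_poly: "minimal_poly \<iota> \<pi> [:\<delta>, - \<tau>, 1:]"
    and val_trace: "val_ge v \<tau> 1" and val_norm: "val_ge v \<delta> 1"
begin

sublocale vs: vector_space "ext_scale \<iota>"
  by (rule vector_space_ext_scale)

lemma p_nonzero [simp]: "p \<noteq> 0" and val_p [simp]: "v p = 1"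
  using uniformizer by (auto simp: uniformizer_def)

lemma emb_zero [simp]: "\<iota> 0 = 0"
  by (metis add.right_neutral add_left_cancel emb_add)

lemma emb_minus: "\<iota> (- x) = - \<iota> x"
  using emb_add[of x "- x"] by (simp add: eq_neg_iff_add_eq_0 add.commute)

lemma emb_diff: "\<iota> (x - y) = \<iota> x - \<iota> y"
  using emb_add[of x "- y"] by (simp add: emb_minus)

lemma emb_eq_zero_iff [simp]: "\<iota> x = 0 \<longleftrightarrow> x = 0"
proof
  assume "\<iota> x = 0"
  then show "x = 0" using emb_mult[of x "inverse x"] emb_one by (cases "x = 0") auto
qed simp

lemma emb_inverse: "\<iota> (inverse x) = inverse (\<iota> x)"
proof (cases "x = 0")
  case False
  then have "\<iota> x * \<iota> (inverse x) = 1" by (simp add: emb_one flip: emb_mult)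
  then show ?thesis by (simp add: inverse_unique)
qed simp

lemma emb_power: "\<iota> (x ^ i) = \<iota> x ^ i"
  by (induction i) (auto simp: emb_one emb_mult)

lemma emb_power_int: "\<iota> (x powi k) = \<iota> x powi k"
  by (auto simp: power_int_def emb_power emb_inverse)

definition elt :: "'k \<Rightarrow> 'k \<Rightarrow> 'l" where
  "elt x y = \<iota> x + \<iota> y * \<pi>"

lemma elt_add: "elt x y + elt x' y' = elt (x + x') (y + y')"
  and elt_diff: "elt x y - elt x' y' = elt (x - x') (y - y')"
  and elt_scale: "ext_scale \<iota> c (elt x y) = elt (c * x) (c * y)"
  and elt_zero [simp]: "elt 0 0 = 0"
  by (simp_all add: elt_def ext_scale_def emb_add emb_diff emb_mult algebra_simps)

lemma pi_square: "\<pi> * \<pi> = \<iota> \<tau> * \<pi> - \<iota> \<delta>"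
proof -
  have "poly (map_poly \<iota> [:\<delta>, - \<tau>, 1:]) \<pi> = 0"
    using minimal_poly by (simp add: minimal_poly_def)
  then have "\<iota> \<delta> + \<pi> * (- \<iota> \<tau> + \<pi>) = 0"
    by (simp add: map_poly_pCons emb_minus emb_one)
  then show ?thesis by (simp add: algebra_simps add_eq_0_iff2)
qed

lemma elt_mult: "elt x y * elt x' y' = elt (x * x' - y * y' * \<delta>) (x * y' + y * x' + y * y' * \<tau>)"
proof -
  have "elt x y * elt x' y' =
      \<iota> x * \<iota> x' + (\<iota> x * \<iota> y' + \<iota> y * \<iota> x') * \<pi> + \<iota> y * \<iota> y' * (\<pi> * \<pi>)"
    by (simp add: elt_def algebra_simps)
  also have "\<dots> = elt (x * x' - y * y' * \<delta>) (x * y' + y * x' + y * y' * \<tau>)"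
    unfolding pi_square by (simp add: elt_def emb_add emb_diff emb_mult algebra_simps)
  finally show ?thesis .
qed

lemma elt_eq_zero:
  assumes "elt x y = 0"
  shows "x = 0" "y = 0"
proof -
  have "[:x, y:] = 0"
  proof (rule ccontr)
    assume "[:x, y:] \<noteq> 0"
    moreover have "poly (map_poly \<iota> [:x, y:]) \<pi> = 0"
      using assms by (simp add: map_poly_pCons elt_def mult.commute)
    ultimately have "degree [:\<delta>, - \<tau>, 1:] \<le> degree [:x, y:]"
      using minimal_poly unfolding minimal_poly_def by blast
    then show False by (simp split: if_splits)
  qed
  then show "x = 0" "y = 0" by auto
qed

lemma elt_eq_iff [simp]: "elt x y = elt x' y' \<longleftrightarrow> x = x' \<and> y = y'"
proof
  assume "elt x y = elt x' y'"
  then have "elt (x - x') (y - y') = 0" by (simp flip: elt_diff)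
  from elt_eq_zero[OF this] show "x = x' \<and> y = y'" by simp
qed simp

lemma span_basis: "vs.span {1, \<pi>} = UNIV"
proof -
  have elt1: "1 = elt 1 0" and eltpi: "\<pi> = elt 0 1" by (simp_all add: elt_def emb_one)
  have ne: "1 \<noteq> \<pi>" by (subst elt1, subst eltpi) simp
  have ind: "vs.independent {1, \<pi>}"
  proof -
    have "vs.independent {\<pi>}" by (subst eltpi) (simp add: elt_zero[symmetric] del: elt_zero)
    moreover have "1 \<notin> vs.span {\<pi>}"
      by (subst elt1, subst eltpi) (auto simp: vs.span_singleton elt_scale)
    ultimately show ?thesis using ne by (simp add: vs.independent_insert)
  qed
  obtain B where B: "vs.independent B" "vs.span B = UNIV" "card B = 2"
    using vs.basis_exists[of UNIV] dim_two by (metis top.extremum_uniqueI)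
  then have "finite B" by (metis card.infinite zero_neq_numeral)
  interpret fd: finite_dimensional_vector_space "ext_scale \<iota>" B
    by unfold_locales (use B \<open>finite B\<close> in auto)
  have "UNIV \<subseteq> vs.span {1, \<pi>}"
    using ind ne dim_two by (intro fd.card_ge_dim_independent) auto
  then show ?thesis by blast
qed

lemma elt_surj: obtains x y where "z = elt x y"
proof -
  have "z \<in> vs.span {1, \<pi>}" using span_basis by simp
  then obtain c c' where "z - ext_scale \<iota> c 1 = ext_scale \<iota> c' \<pi>"
    by (auto simp: vs.span_insert vs.span_singleton)
  then have "z = elt c c'" by (simp add: elt_def ext_scale_def algebra_simps)
  then show ?thesis by (rule that)
qed

text \<open>Written in the coordinates \<open>elt x y\<close>, this is \<open>p\<^sup>j\<close> times the lattice with basis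
  \<open>1 + a\<pi>, p\<^sup>k\<pi>\<close>.\<close>

definition lat :: "'k \<Rightarrow> int \<Rightarrow> int \<Rightarrow> 'l set" where
  "lat a j k = {elt x y | x y. val_ge v x j \<and> val_ge v (y - a * x) (j + k)}"

lemma elt_in_lat_iff [simp]:
  "elt x y \<in> lat a j k \<longleftrightarrow> val_ge v x j \<and> val_ge v (y - a * x) (j + k)"
  by (auto simp: lat_def)

lemma lat_subset_iff:
  "lat a j k \<subseteq> lat b j' k' \<longleftrightarrow> j' \<le> j \<and> j' + k' \<le> j + k \<and> val_ge v (a - b) (j' + k' - j)"
    (is "?L \<longleftrightarrow> ?R")
proof
  assume L: ?L
  have pj: "p powi j \<noteq> 0" "v (p powi j) = j" "p powi (j + k) \<noteq> 0" "v (p powi (j + k)) = j + k"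
    by (auto simp: val_power_int)
  have "elt (p powi j) (a * p powi j) \<in> lat a j k" "elt 0 (p powi (j + k)) \<in> lat a j k"
    using pj by (simp_all add: val_ge_iff)
  with L have "elt (p powi j) (a * p powi j) \<in> lat b j' k'" "elt 0 (p powi (j + k)) \<in> lat b j' k'"
    by blast+
  moreover have "a * p powi j - b * p powi j = p powi j * (a - b)" by (simp add: algebra_simps)
  ultimately show ?R using pj by (simp add: val_ge_iff val_ge_mult_iff)
next
  assume R: ?R
  show ?L
  proof
    fix z assume "z \<in> lat a j k"
    then obtain x y where z: "z = elt x y" "val_ge v x j" "val_ge v (y - a * x) (j + k)"
      by (auto simp: lat_def)
    have "val_ge v ((a - b) * x) (j' + k')"
      using val_ge_mult[OF _ z(2), of "a - b" "j' + k' - j"] R by simp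
    moreover have "val_ge v (y - a * x) (j' + k')" using z(3) R val_ge_mono by blast
    ultimately have "val_ge v ((y - a * x) + (a - b) * x) (j' + k')" by (rule val_ge_add[rotated])
    then show "z \<in> lat b j' k'" using z R val_ge_mono by (auto simp: algebra_simps)
  qed
qed

lemma lat_eq_iff: "lat a j k = lat b j' k' \<longleftrightarrow> j = j' \<and> k = k' \<and> val_ge v (a - b) k"
  by (auto simp: set_eq_subset lat_subset_iff val_ge_commute[of b a])

lemma scale_lat:
  assumes "c \<noteq> 0"
  shows "ext_scale \<iota> c ` lat a j k = lat a (v c + j) k"
proof -
  have *: "elt (c * x) (c * y) \<in> lat a (v c + j) k \<longleftrightarrow> elt x y \<in> lat a j k" for x y
  proof -
    have "c * y - a * (c * x) = c * (y - a * x)" by (simp add: algebra_simps)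
    then show ?thesis using assms by (simp add: val_ge_mult_iff)
  qed
  show ?thesis
  proof (intro equalityI subsetI)
    fix z assume "z \<in> ext_scale \<iota> c ` lat a j k"
    then obtain x y where "z = ext_scale \<iota> c (elt x y)" "elt x y \<in> lat a j k"
      by (metis elt_surj imageE)
    then show "z \<in> lat a (v c + j) k" using * by (simp add: elt_scale)
  next
    fix z assume z: "z \<in> lat a (v c + j) k"
    obtain x y where xy: "z = elt x y" by (rule elt_surj)
    then have zz: "z = ext_scale \<iota> c (elt (x / c) (y / c))"
      using assms by (simp add: elt_scale)
    then have "elt (x / c) (y / c) \<in> lat a j k"
      using z assms xy *[of "x / c" "y / c"] by (simp del: elt_in_lat_iff)
    with zz show "z \<in> ext_scale \<iota> c ` lat a j k" by blast
  qed
qed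

definition vtx :: "'k \<Rightarrow> int \<Rightarrow> 'l set set" where
  "vtx a k = range (\<lambda>j. lat a j k)"

lemma homothety_class_lat: "homothety_class \<iota> (lat a j k) = vtx a k"
proof -
  have "\<exists>c. c \<noteq> 0 \<and> lat a i k = ext_scale \<iota> c ` lat a j k" for i
    by (rule exI[of _ "p powi (i - j)"]) (simp add: scale_lat val_power_int)
  then have "vtx a k \<subseteq> homothety_class \<iota> (lat a j k)"
    unfolding homothety_class_def vtx_def by blast
  moreover have "homothety_class \<iota> (lat a j k) \<subseteq> vtx a k"
    by (auto simp: homothety_class_def vtx_def scale_lat)
  ultimately show ?thesis by (rule equalityI[rotated])
qed

lemma vtx_eq_iff: "vtx a k = vtx b l \<longleftrightarrow> k = l \<and> val_ge v (a - b) k"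
proof
  assume "vtx a k = vtx b l"
  then have "lat a 0 k \<in> vtx b l" by (auto simp: vtx_def)
  then show "k = l \<and> val_ge v (a - b) k" by (auto simp: vtx_def lat_eq_iff)
next
  assume "k = l \<and> val_ge v (a - b) k"
  then have "lat a j k = lat b j l" for j by (auto simp: lat_eq_iff)
  then show "vtx a k = vtx b l" by (simp add: vtx_def)
qed

lemma bt_adjacent_vtx_iff:
  "bt_adjacent \<iota> p (vtx a k) (vtx b l) \<longleftrightarrow>
     vtx b l = vtx a (k - 1) \<or> vtx a k = vtx b (l - 1)" (is "?L \<longleftrightarrow> ?R")
proof
  assume ?L
  then obtain j j' where "lat a (1 + j) k \<subset> lat b j' l" "lat b j' l \<subset> lat a j k"
    by (auto simp: bt_adjacent_def vtx_def scale_lat)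
  then have *: "j' \<le> 1 + j" "j' + l \<le> 1 + j + k" "val_ge v (a - b) (j' + l - (1 + j))"
      "j \<le> j'" "j + k \<le> j' + l" "val_ge v (b - a) (j + k - j')"
      "\<not> (j = j' \<and> k = l \<and> val_ge v (a - b) k)"
      "\<not> (1 + j = j' \<and> k = l \<and> val_ge v (a - b) k)"
    by (auto simp: psubset_eq lat_subset_iff lat_eq_iff val_ge_commute[of b a])
  from *(6) have ab: "val_ge v (a - b) (j + k - j')" using val_ge_commute by blast
  show ?R
  proof (cases "j' = j")
    case True
    with *(7) ab have "l \<noteq> k" by auto
    with True *(2,5) have "l = k + 1" by simp
    with True ab show ?thesis by (simp add: vtx_eq_iff)
  next
    case False
    with *(1,4) have j': "j' = 1 + j" by simp
    with *(3,8) have "l \<noteq> k" by auto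
    with j' *(2,5) have "l = k - 1" by simp
    with j' *(6) show ?thesis by (simp add: vtx_eq_iff)
  qed
next
  assume ?R
  then consider "l = k - 1" "val_ge v (b - a) l" | "k = l - 1" "val_ge v (a - b) k"
    by (auto simp: vtx_eq_iff)
  then obtain j where "lat a 1 k \<subset> lat b j l" "lat b j l \<subset> lat a 0 k"
  proof cases
    case 1
    then show ?thesis
      by (intro that[of 1])
        (auto simp: psubset_eq lat_subset_iff lat_eq_iff val_ge_commute[of b a])
  next
    case 2
    then show ?thesis
      by (intro that[of 0])
        (auto simp: psubset_eq lat_subset_iff lat_eq_iff val_ge_commute[of b a])
  qed
  moreover have "ext_scale \<iota> p ` lat a 0 k = lat a 1 k" by (simp add: scale_lat)
  ultimately show ?L unfolding bt_adjacent_def vtx_def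
    by (intro bexI[of _ "lat a 0 k"] bexI[of _ "lat b j l"]) auto
qed

lemma lat_add: "s \<in> lat a j k \<Longrightarrow> t \<in> lat a j k \<Longrightarrow> s + t \<in> lat a j k"
proof -
  assume "s \<in> lat a j k" "t \<in> lat a j k"
  then obtain x y x' y' where *: "s = elt x y" "t = elt x' y'"
      "val_ge v x j" "val_ge v (y - a * x) (j + k)" "val_ge v x' j" "val_ge v (y' - a * x') (j + k)"
    by (auto simp: lat_def)
  have "val_ge v (y + y' - a * (x + x')) (j + k)"
    using val_ge_add[OF *(4) *(6)] by (simp add: algebra_simps)
  with * show ?thesis by (simp add: elt_add val_ge_add)
qed

lemma lat_scale: "c \<in> val_ring v \<Longrightarrow> s \<in> lat a j k \<Longrightarrow> ext_scale \<iota> c s \<in> lat a j k"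
proof -
  assume c: "c \<in> val_ring v" and "s \<in> lat a j k"
  then obtain x y where *: "s = elt x y" "val_ge v x j" "val_ge v (y - a * x) (j + k)"
    by (auto simp: lat_def)
  have "c * y - a * (c * x) = c * (y - a * x)" by (simp add: algebra_simps)
  moreover have "val_ge v (c * z) i" if "val_ge v z i" for z i
    using val_ge_mult[OF _ that, of c 0] c by (simp add: val_ring_def)
  ultimately show ?thesis using * by (simp add: elt_scale)
qed

lemma lattice_of_subset_lat:
  assumes "S \<subseteq> lat a j k"
  shows "lattice_of v \<iota> S \<subseteq> lat a j k"
proof -
  have "0 \<in> lat a j k" by (simp flip: elt_zero)
  then have "(\<Sum>s\<in>S'. ext_scale \<iota> (c s) s) \<in> lat a j k"
    if "S' \<subseteq> S" "\<forall>s\<in>S. c s \<in> val_ring v" for c S'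
    using that assms
    by (induction S' rule: infinite_finite_induct) (auto intro!: lat_add lat_scale)
  then show ?thesis by (auto simp: lattice_of_def)
qed

lemma lattice_of_two:
  assumes "finite S" "s \<in> S" "t \<in> S" "s \<noteq> t" "c \<in> val_ring v" "c' \<in> val_ring v"
  shows "ext_scale \<iota> c s + ext_scale \<iota> c' t \<in> lattice_of v \<iota> S"
proof -
  define f where "f = (\<lambda>r. if r = s then c else if r = t then c' else 0)"
  have "(\<Sum>r\<in>S. ext_scale \<iota> (f r) r) = (\<Sum>r\<in>{s, t}. ext_scale \<iota> (f r) r)"
    using assms by (intro sum.mono_neutral_right) (auto simp: f_def)
  also have "\<dots> = ext_scale \<iota> c s + ext_scale \<iota> c' t" using assms by (simp add: f_def)
  finally show ?thesis
    using assms by (auto simp: lattice_of_def f_def val_ring_def intro!: exI[of _ f])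
qed

text \<open>The generator with the first coordinate of least valuation provides \<open>a\<close> and \<open>j\<close>; subtracting
  multiples of it from the other generators leaves multiples of \<open>\<pi>\<close>, the largest of which provides
  \<open>k\<close>.\<close>

lemma is_lattice_imp_lat:
  assumes "is_lattice v \<iota> \<Lambda>"
  obtains a j k where "\<Lambda> = lat a j k"
proof -
  from assms obtain S where S: "finite S" "\<Lambda> = lattice_of v \<iota> S" and span: "vs.span \<Lambda> = UNIV"
    by (auto simp: is_lattice_def)
  have nonzero: "\<exists>s\<in>S. f s \<noteq> 0"
    if f: "\<And>s t. f (s + t) = f s + f t" "\<And>c s. f (ext_scale \<iota> c s) = c * f s"
      and "f z \<noteq> 0" for f :: "'l \<Rightarrow> 'k" and z
  proof (rule ccontr)
    assume "\<not> (\<exists>s\<in>S. f s \<noteq> 0)"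
    then have S0: "\<forall>s\<in>S. f s = 0" by blast
    have f0: "f 0 = 0" using f(2)[of 0 0] by simp
    have "f (\<Sum>s\<in>S'. ext_scale \<iota> (c s) s) = 0" if "S' \<subseteq> S" for S' c
      using that S0 by (induction S' rule: infinite_finite_induct) (auto simp: f f0)
    then have "\<Lambda> \<subseteq> {z. f z = 0}" by (auto simp: S lattice_of_def)
    then have "vs.span \<Lambda> \<subseteq> {z. f z = 0}"
      by (rule vs.span_minimal) (auto simp: vs.subspace_def f f0)
    with span \<open>f z \<noteq> 0\<close> show False by auto
  qed
  have least: "\<exists>s\<in>S. f s \<noteq> 0 \<and> (\<forall>t\<in>S. val_ge v (f t) (v (f s)))"
    if "\<exists>s\<in>S. f s \<noteq> 0" for f :: "'l \<Rightarrow> 'k"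
  proof -
    have "finite {s \<in> S. f s \<noteq> 0}" "{s \<in> S. f s \<noteq> 0} \<noteq> {}" using S that by auto
    from ex_min_if_finite[OF finite_imageI[OF this(1), of "\<lambda>s. v (f s)"]] this(2)
    obtain s where "s \<in> S" "f s \<noteq> 0" "\<forall>t\<in>S. f t \<noteq> 0 \<longrightarrow> v (f s) \<le> v (f t)"
      by (auto simp: not_less)
    then show ?thesis by (auto simp: val_ge_def)
  qed
  define X where "X z = (THE x. \<exists>y. z = elt x y)" for z
  define Y where "Y z = (THE y. \<exists>x. z = elt x y)" for z
  have XY [simp]: "X (elt x y) = x" "Y (elt x y) = y" for x y by (auto simp: X_def Y_def)
  have elt_XY: "z = elt (X z) (Y z)" for z by (metis XY elt_surj)
  have lin: "X (s + t) = X s + X t" "Y (s + t) = Y s + Y t"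
      "X (ext_scale \<iota> c s) = c * X s" "Y (ext_scale \<iota> c s) = c * Y s" for s t c
    by (metis XY elt_surj elt_add, metis XY elt_surj elt_add,
        metis XY elt_surj elt_scale, metis XY elt_surj elt_scale)
  obtain s where s: "s \<in> S" "X s \<noteq> 0" "\<forall>t\<in>S. val_ge v (X t) (v (X s))"
    using least[OF nonzero[of X "elt 1 0"]] by (auto simp: lin)
  define a where "a = Y s / X s"
  define Z where "Z z = Y z - a * X z" for z
  have lin_Z: "Z (s + t) = Z s + Z t" "Z (ext_scale \<iota> c s) = c * Z s" for s t c
    by (simp_all add: Z_def lin algebra_simps)
  obtain t where t: "t \<in> S" "Z t \<noteq> 0" "\<forall>r\<in>S. val_ge v (Z r) (v (Z t))"
  proof -
    have "Z (elt 0 1) \<noteq> 0" by (simp add: Z_def)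
    from least[OF nonzero[of Z, OF lin_Z this]] that show ?thesis by blast
  qed
  define j k where "j = v (X s)" and "k = v (Z t) - v (X s)"
  have in_lat: "z \<in> lat a j k \<longleftrightarrow> val_ge v (X z) j \<and> val_ge v (Z z) (v (Z t))" for z
    by (subst elt_XY) (simp add: Z_def j_def k_def)
  have "Z s = 0" using s by (simp add: Z_def a_def)
  then have "s \<noteq> t" using t by auto
  have "\<Lambda> = lat a j k"
  proof
    show "\<Lambda> \<subseteq> lat a j k"
      unfolding S(2)
    proof (rule lattice_of_subset_lat, rule subsetI)
      show "r \<in> lat a j k" if "r \<in> S" for r
        using s(3) t(3) that unfolding in_lat unfolding j_def by blast
    qed
    show "lat a j k \<subseteq> \<Lambda>"
    proof
      fix z assume "z \<in> lat a j k"
      then have z: "val_ge v (X z) j" "val_ge v (Z z) (v (Z t))" by (simp_all add: in_lat)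
      define c' where "c' = Z z / Z t"
      define c where "c = (X z - c' * X t) / X s"
      have c': "val_ge v c' 0" using z t by (simp add: c'_def val_ge_divide_iff)
      then have "val_ge v (c' * X t) j"
        using val_ge_mult[OF c', of "X t" j] s t by (simp add: j_def)
      then have c: "val_ge v c 0"
        using z s by (simp add: c_def val_ge_divide_iff val_ge_diff j_def)
      have Xz: "c * X s + c' * X t = X z" using s by (simp add: c_def)
      have Zz: "c * Z s + c' * Z t = Z z" using t \<open>Z s = 0\<close> by (simp add: c'_def)
      have "Y z = Z z + a * X z" by (simp add: Z_def)
      also have "\<dots> = c * Y s + c' * Y t" unfolding Xz[symmetric] Zz[symmetric]
        by (simp add: Z_def algebra_simps)
      finally have "z = ext_scale \<iota> c s + ext_scale \<iota> c' t"
        by (metis Xz elt_XY lin)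
      then show "z \<in> \<Lambda>"
        using lattice_of_two[OF S(1) s(1) t(1) \<open>s \<noteq> t\<close>] c c' by (simp add: S val_ring_def)
    qed
  qed
  then show ?thesis by (rule that)
qed

lemma is_lattice_lat: "is_lattice v \<iota> (lat a 0 k)"
proof -
  define s t where "s = elt 1 a" and "t = elt 0 (p powi k)"
  have "s \<noteq> t" by (simp add: s_def t_def)
  have comb: "ext_scale \<iota> x s + ext_scale \<iota> ((y - a * x) / p powi k) t = elt x y" for x y
    by (simp add: s_def t_def elt_scale elt_add mult.commute)
  have st: "s \<in> lat a 0 k" "t \<in> lat a 0 k"
    by (simp_all add: s_def t_def val_ge_iff val_power_int)
  have "lat a 0 k = lattice_of v \<iota> {s, t}"
  proof
    show "lattice_of v \<iota> {s, t} \<subseteq> lat a 0 k" by (rule lattice_of_subset_lat) (use st in auto)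
    show "lat a 0 k \<subseteq> lattice_of v \<iota> {s, t}"
    proof
      fix z assume "z \<in> lat a 0 k"
      then obtain x y where z: "z = elt x y" "val_ge v x 0" "val_ge v (y - a * x) k"
        by (auto simp: lat_def)
      have "ext_scale \<iota> x s + ext_scale \<iota> ((y - a * x) / p powi k) t \<in> lattice_of v \<iota> {s, t}"
        by (rule lattice_of_two)
          (use z \<open>s \<noteq> t\<close> in \<open>auto simp: val_ring_def val_ge_divide_iff val_power_int\<close>)
      then show "z \<in> lattice_of v \<iota> {s, t}" by (simp only: comb z)
    qed
  qed
  moreover have "vs.span (lat a 0 k) = UNIV"
  proof -
    have "z \<in> vs.span (lat a 0 k)" for z
    proof -
      obtain x y where z: "z = elt x y" by (rule elt_surj)
      show ?thesis unfolding z
        by (subst comb[symmetric]) (intro vs.span_add vs.span_scale vs.span_base st)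
    qed
    then show ?thesis by blast
  qed
  ultimately show ?thesis unfolding is_lattice_def by (intro conjI exI[of _ "{s, t}"]) simp_all
qed

lemma bt_vertices_eq: "bt_vertices v \<iota> = {vtx a k | a k. True}"
proof -
  have "vtx a k \<in> bt_vertices v \<iota>" for a k
    unfolding bt_vertices_def
    by (rule image_eqI[of _ _ "lat a 0 k"]) (simp_all add: is_lattice_lat homothety_class_lat)
  moreover have "\<exists>a k. x = vtx a k" if "x \<in> bt_vertices v \<iota>" for x
    using that unfolding bt_vertices_def by (metis homothety_class_lat imageE is_lattice_imp_lat mem_Collect_eq)
  ultimately show ?thesis by blast
qed

definition parent :: "'l set set \<Rightarrow> 'l set set" where
  "parent x = (THE y. \<exists>a k. x = vtx a k \<and> y = vtx a (k - 1))"

definition height :: "'l set set \<Rightarrow> int" where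
  "height x = (THE k. \<exists>a. x = vtx a k)"

lemma parent_vtx [simp]: "parent (vtx a k) = vtx a (k - 1)"
  unfolding parent_def
proof (rule the_equality)
  fix y assume "\<exists>b l. vtx a k = vtx b l \<and> y = vtx b (l - 1)"
  then obtain b where y: "val_ge v (a - b) k" "y = vtx b (k - 1)"
    by (auto simp: vtx_eq_iff)
  then have "val_ge v (b - a) (k - 1)"
    using val_ge_mono[of "b - a" k "k - 1"] val_ge_commute[of a b] by simp
  with y(2) show "y = vtx a (k - 1)" by (simp add: vtx_eq_iff)
qed blast

lemma height_vtx [simp]: "height (vtx a k) = k"
  unfolding height_def by (rule the_equality, blast) (auto simp: vtx_eq_iff)

lemma funpow_parent_vtx: "(parent ^^ d) (vtx a k) = vtx a (k - int d)"
  by (induction d) (auto simp: algebra_simps)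

lemma end_rooted_tree_bt_tree: "end_rooted_tree (bt_tree v \<iota> p) parent height"
proof -
  interpret wf_digraph "bt_tree v \<iota> p" by (rule wf_digraph_bt_tree)
  show ?thesis
  proof
    fix x assume "x \<in> verts (bt_tree v \<iota> p)"
    then obtain a k where x: "x = vtx a k" by (auto simp: bt_tree_def bt_vertices_eq)
    then have "parent x = vtx a (k - 1)" by simp
    then show "parent x \<in> verts (bt_tree v \<iota> p)"
      unfolding bt_tree_def bt_vertices_eq by (simp only: pre_digraph.simps) blast
    show "height (parent x) = height x - 1" by (simp add: x)
  qed (auto simp: bt_tree_def bt_vertices_eq bt_adjacent_vtx_iff)
qed

lemma ring_O_eq: "ring_O v \<iota> p \<pi> m = lat 0 0 m"
proof -
  have "\<iota> x + \<iota> y * \<iota> p powi m * \<pi> = elt x (y * p powi m)" for x y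
    by (simp add: elt_def emb_mult emb_power_int)
  then have "ring_O v \<iota> p \<pi> m = {elt x (y * p powi m) | x y. val_ge v x 0 \<and> val_ge v y 0}"
    by (simp add: ring_O_def val_ring_def)
  also have "\<dots> = lat 0 0 m"
  proof (intro equalityI subsetI)
    fix z assume "z \<in> lat 0 0 m"
    then obtain x y where z: "z = elt x y" "val_ge v x 0" "val_ge v y m" by (auto simp: lat_def)
    then have "z = elt x (y / p powi m * p powi m)" "val_ge v (y / p powi m) 0"
      by (auto simp: val_ge_divide_iff val_power_int)
    with z(2) show "z \<in> {elt x (y * p powi m) | x y. val_ge v x 0 \<and> val_ge v y 0}" by blast
  next
    fix z assume "z \<in> {elt x (y * p powi m) | x y. val_ge v x 0 \<and> val_ge v y 0}"
    then show "z \<in> lat 0 0 m"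
      by (auto simp: mult.commute[of _ "p powi m"] val_ge_mult_iff val_power_int)
  qed
  finally show ?thesis .
qed

subsection \<open>The action of units\<close>

lemma mult_lat:
  assumes a: "val_ge v a 0" and n: "0 \<le> n"
  shows "(\<lambda>z. elt 1 a * z) ` lat 0 0 n = lat a 0 n"
proof -
  define \<epsilon> where "\<epsilon> = 1 + (a * \<tau> + a * a * \<delta>)"
  have "val_ge v (a * \<tau> + a * a * \<delta>) 1"
    using val_ge_mult[OF a val_trace] val_ge_mult[OF val_ge_mult[OF a a] val_norm]
    by (simp add: val_ge_add)
  then have \<epsilon>: "\<epsilon> \<noteq> 0" "v \<epsilon> = 0" using val_one_plus by (simp_all add: \<epsilon>_def)
  have int_mult: "val_ge v (a * t * \<delta>) 0" if "val_ge v t n" for t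
    using val_ge_mult[OF val_ge_mult[OF a that] val_norm] n by (auto elim: val_ge_mono)
  have prod: "elt 1 a * elt s t = elt (s - a * t * \<delta>) (a * (s - a * t * \<delta>) + t * \<epsilon>)" for s t
    by (simp add: elt_mult \<epsilon>_def algebra_simps)
  show ?thesis
  proof (intro equalityI subsetI)
    fix z assume "z \<in> (\<lambda>z. elt 1 a * z) ` lat 0 0 n"
    then obtain s t where st: "z = elt 1 a * elt s t" "val_ge v s 0" "val_ge v t n"
      by (auto simp: lat_def)
    then show "z \<in> lat a 0 n"
      using \<epsilon> int_mult by (simp add: prod val_ge_diff mult.commute[of t] val_ge_mult_iff)
  next
    fix z assume "z \<in> lat a 0 n"
    then obtain x y where xy: "z = elt x y" "val_ge v x 0" "val_ge v (y - a * x) n"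
      by (auto simp: lat_def)
    define t where "t = (y - a * x) / \<epsilon>"
    define s where "s = x + a * t * \<delta>"
    have t: "val_ge v t n" using xy \<epsilon> by (simp add: t_def val_ge_divide_iff)
    then have "val_ge v s 0" using xy int_mult by (simp add: s_def val_ge_add)
    moreover have "z = elt 1 a * elt s t"
      unfolding prod using \<epsilon> xy(1) by (simp add: s_def t_def)
    ultimately show "z \<in> (\<lambda>z. elt 1 a * z) ` lat 0 0 n" using t by auto
  qed
qed

definition slope :: "'l \<Rightarrow> 'k \<Rightarrow> bool" where
  "slope u a \<longleftrightarrow> val_ge v a 0 \<and> (\<exists>c. c \<noteq> 0 \<and> u = ext_scale \<iota> c (elt 1 a))"

lemma homothety_class_mult_ring_O:
  assumes "slope u a" and "0 \<le> n"
  shows "homothety_class \<iota> ((\<lambda>z. u * z) ` ring_O v \<iota> p \<pi> n) = vtx a n"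
proof -
  from assms obtain c where c: "val_ge v a 0" "c \<noteq> 0" "u = ext_scale \<iota> c (elt 1 a)"
    by (auto simp: slope_def)
  have "(\<lambda>z. u * z) ` ring_O v \<iota> p \<pi> n = ext_scale \<iota> c ` (\<lambda>z. elt 1 a * z) ` lat 0 0 n"
    by (simp add: ring_O_eq c(3) image_image ext_scale_def mult.assoc)
  also have "\<dots> = lat a (v c) n"
    using c assms(2) by (simp add: mult_lat scale_lat)
  finally show ?thesis by (simp add: homothety_class_lat)
qed

text \<open>The slope of \<open>(1 + a\<pi>)(1 + b\<pi>)\<close> is \<open>(a + b + ab\<tau>) / (1 - ab\<delta>)\<close>, and \<open>p\<close> divides both \<open>\<tau>\<close> and
  \<open>\<delta>\<close>.\<close>

lemma slope_mult_unit_u: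
  assumes u: "slope u a" and t: "val_ge v t 0"
  obtains a' where "slope (u * unit_u \<iota> p \<pi> i t) a'"
    "val_ge v (a' - (a + t * p ^ i)) (int i + 1)"
proof -
  from u obtain c where a: "val_ge v a 0" and c: "c \<noteq> 0" "u = ext_scale \<iota> c (elt 1 a)"
    by (auto simp: slope_def)
  define b where "b = t * p ^ i"
  have b: "val_ge v b (int i)"
    using t by (simp add: b_def mult.commute[of t] val_ge_mult_iff val_power)
  then have b0: "val_ge v b 0" by (rule val_ge_mono) simp
  have ab: "val_ge v (a * b) (int i)" using val_ge_mult[OF a b] by simp
  define \<epsilon> where "\<epsilon> = 1 + - (a * b * \<delta>)"
  have ab\<delta>: "val_ge v (a * b * \<delta>) (int i + 1)" by (rule val_ge_mult[OF ab val_norm])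
  then have "val_ge v (- (a * b * \<delta>)) 1" by (auto elim: val_ge_mono)
  then have \<epsilon>: "\<epsilon> \<noteq> 0" "v \<epsilon> = 0" unfolding \<epsilon>_def by (rule val_one_plus)+
  define a' where "a' = (a + b + a * b * \<tau>) / \<epsilon>"
  have diff: "a' - (a + b) = (a * b * \<tau> + a * b * \<delta> * (a + b)) / \<epsilon>"
    using \<epsilon> by (simp add: a'_def divide_simps) (simp add: \<epsilon>_def algebra_simps)
  have "val_ge v (a * b * \<delta> * (a + b)) (int i + 1)"
    using val_ge_mult[OF ab\<delta> val_ge_add[OF a b0]] by simp
  then have close: "val_ge v (a' - (a + b)) (int i + 1)"
    unfolding diff using \<epsilon> val_ge_mult[OF ab val_trace] by (simp add: val_ge_divide_iff val_ge_add)
  then have "val_ge v (a' - (a + b)) 0" by (rule val_ge_mono) simp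
  from val_ge_add[OF this val_ge_add[OF a b0]] have a': "val_ge v a' 0" by simp
  have "unit_u \<iota> p \<pi> i t = elt 1 b"
    by (simp add: unit_u_def elt_def b_def emb_one emb_mult emb_power)
  then have "u * unit_u \<iota> p \<pi> i t = ext_scale \<iota> c (elt 1 a * elt 1 b)"
    by (simp add: c(2) ext_scale_def mult.assoc)
  also have "elt 1 a * elt 1 b = ext_scale \<iota> \<epsilon> (elt 1 a')"
    using \<epsilon>(1) by (simp add: elt_mult elt_scale a'_def) (simp add: \<epsilon>_def algebra_simps)
  finally have "slope (u * unit_u \<iota> p \<pi> i t) a'"
    using a' c(1) \<epsilon>(1) by (auto simp: slope_def intro!: exI[of _ "c * \<epsilon>"])
  with close show ?thesis using that b_def by blast
qed

lemma slope_one: "slope 1 0"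
  by (auto simp: slope_def elt_def ext_scale_def emb_one intro!: exI[of _ 1])

lemma slope_prod:
  assumes "\<And>i. i \<in> {m..<m + d} \<Longrightarrow> val_ge v (\<alpha> i) 0"
  shows "\<exists>a. slope (\<Prod>i\<in>{m..<m + d}. unit_u \<iota> p \<pi> i (\<alpha> i)) a \<and> val_ge v a (int m)"
  using assms
proof (induction d)
  case 0
  then show ?case using slope_one by (auto intro!: exI[of _ 0])
next
  case (Suc d)
  then obtain a where a: "slope (\<Prod>i\<in>{m..<m + d}. unit_u \<iota> p \<pi> i (\<alpha> i)) a" "val_ge v a (int m)"
    by fastforce
  have \<alpha>: "val_ge v (\<alpha> (m + d)) 0" using Suc.prems by simp
  obtain a' where a': "slope (\<Prod>i\<in>{m..<m + Suc d}. unit_u \<iota> p \<pi> i (\<alpha> i)) a'"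
      "val_ge v (a' - (a + \<alpha> (m + d) * p ^ (m + d))) (int (m + d) + 1)"
    using slope_mult_unit_u[OF a(1) \<alpha>, of "m + d"] by auto
  have "val_ge v (\<alpha> (m + d) * p ^ (m + d)) (int m)"
    using \<alpha> by (simp add: mult.commute[of _ "p ^ _"] val_ge_mult_iff val_power)
      (auto elim: val_ge_mono)
  from val_ge_add[OF a(2) this] val_ge_mono[OF a'(2), of "int m"]
  have "val_ge v a' (int m)"
    using val_ge_add by fastforce
  with a'(1) show ?case by blast
qed

lemma slope_prod_surj:
  assumes R: "residue_reps v p R" and b: "val_ge v b (int m)"
  shows "\<exists>\<alpha> a. \<alpha> \<in> {m..<m + d} \<rightarrow>\<^sub>E R \<and>
    slope (\<Prod>i\<in>{m..<m + d}. unit_u \<iota> p \<pi> i (\<alpha> i)) a \<and> val_ge v (a - b) (int (m + d))"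
proof (induction d)
  case 0
  then show ?case using slope_one b by (auto intro!: exI[of _ 0])
next
  case (Suc d)
  then obtain \<alpha> a where \<alpha>: "\<alpha> \<in> {m..<m + d} \<rightarrow>\<^sub>E R"
    and a: "slope (\<Prod>i\<in>{m..<m + d}. unit_u \<iota> p \<pi> i (\<alpha> i)) a"
    and ab: "val_ge v (a - b) (int (m + d))" by blast
  define q where "q = p ^ (m + d)"
  have q: "q \<noteq> 0" "v q = int (m + d)" by (simp_all add: q_def val_power)
  define r where "r = (b - a) / q"
  have "r \<in> val_ring v"
    using ab q val_ge_commute[of a b] by (simp add: r_def val_ring_def val_ge_divide_iff)
  then obtain t z where t: "t \<in> R" and z: "z \<in> val_ring v" and rt: "r - t = p * z"
    using R unfolding residue_reps_def by blast
  have "val_ge v t 0" using R t by (auto simp: residue_reps_def val_ring_def)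
  from slope_mult_unit_u[OF a this, of "m + d"] obtain a'
    where a': "slope ((\<Prod>i\<in>{m..<m + d}. unit_u \<iota> p \<pi> i (\<alpha> i)) * unit_u \<iota> p \<pi> (m + d) t) a'"
      and close: "val_ge v (a' - (a + t * q)) (int (m + d) + 1)"
    unfolding q_def by blast
  have "b - a = q * r" using q by (simp add: r_def)
  then have "a + t * q - b = - (q * (p * z))"
    unfolding rt[symmetric] by (simp add: algebra_simps)
  then have "val_ge v (a + t * q - b) (int (m + d) + 1)"
    using q z by (simp add: val_ge_mult_iff val_ring_def)
  from val_ge_trans[OF close this] have a'b: "val_ge v (a' - b) (int (m + Suc d))"
    by (simp add: ac_simps)
  define \<alpha>' where "\<alpha>' = \<alpha>(m + d := t)"
  have "\<alpha>' \<in> {m..<m + Suc d} \<rightarrow>\<^sub>E R"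
    using \<alpha> t by (auto simp: \<alpha>'_def PiE_iff extensional_def)
  moreover have "(\<Prod>i\<in>{m..<m + Suc d}. unit_u \<iota> p \<pi> i (\<alpha>' i)) =
      (\<Prod>i\<in>{m..<m + d}. unit_u \<iota> p \<pi> i (\<alpha> i)) * unit_u \<iota> p \<pi> (m + d) t"
    by (simp add: \<alpha>'_def)
  ultimately show ?case using a' a'b by metis
qed

lemma orbit_eq_descendants:
  assumes R: "residue_reps v p R" and "d \<le> n"
  shows "{homothety_class \<iota> ((\<lambda>z. u_prod \<iota> p \<pi> d n \<alpha> * z) ` ring_O v \<iota> p \<pi> (int n)) | \<alpha>.
            \<alpha> \<in> index_I R d n} =
         {vtx a (int n) | a. val_ge v a (int n - int d)}"
proof -
  define m where "m = n - d"
  have n: "n = m + d" and md: "int n - int d = int m" using \<open>d \<le> n\<close> by (simp_all add: m_def)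
  have u_prod: "u_prod \<iota> p \<pi> d n \<alpha> = (\<Prod>i\<in>{m..<m + d}. unit_u \<iota> p \<pi> i (\<alpha> i))" for \<alpha>
    by (simp add: u_prod_def n)
  have index: "index_I R d n = {m..<m + d} \<rightarrow>\<^sub>E R" by (simp add: index_I_def n)
  have cls: "homothety_class \<iota> ((\<lambda>z. u_prod \<iota> p \<pi> d n \<alpha> * z) ` ring_O v \<iota> p \<pi> (int n)) = vtx a (int n)"
    if "slope (\<Prod>i\<in>{m..<m + d}. unit_u \<iota> p \<pi> i (\<alpha> i)) a" for \<alpha> a
    using that by (simp add: u_prod homothety_class_mult_ring_O)
  show ?thesis
  proof (intro equalityI subsetI)
    fix x
    assume "x \<in> {homothety_class \<iota> ((\<lambda>z. u_prod \<iota> p \<pi> d n \<alpha> * z) ` ring_O v \<iota> p \<pi> (int n)) | \<alpha>.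
      \<alpha> \<in> index_I R d n}"
    then obtain \<alpha> where \<alpha>: "\<alpha> \<in> {m..<m + d} \<rightarrow>\<^sub>E R"
      and x: "x = homothety_class \<iota> ((\<lambda>z. u_prod \<iota> p \<pi> d n \<alpha> * z) ` ring_O v \<iota> p \<pi> (int n))"
      unfolding index by blast
    have "val_ge v (\<alpha> i) 0" if "i \<in> {m..<m + d}" for i
      using PiE_mem[OF \<alpha> that] R by (auto simp: residue_reps_def val_ring_def)
    from slope_prod[of m d \<alpha>, OF this] obtain a
      where "slope (\<Prod>i\<in>{m..<m + d}. unit_u \<iota> p \<pi> i (\<alpha> i)) a" "val_ge v a (int m)"
      by blast
    with x show "x \<in> {vtx a (int n) | a. val_ge v a (int n - int d)}"
      using cls md by auto
  next
    fix x assume "x \<in> {vtx a (int n) | a. val_ge v a (int n - int d)}"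
    then obtain b where b: "x = vtx b (int n)" "val_ge v b (int m)" using md by auto
    from slope_prod_surj[OF R b(2), of d] obtain \<alpha> a where \<alpha>: "\<alpha> \<in> index_I R d n"
      and a: "slope (\<Prod>i\<in>{m..<m + d}. unit_u \<iota> p \<pi> i (\<alpha> i)) a" "val_ge v (a - b) (int n)"
      by (metis index n)
    have "x = vtx a (int n)" using b(1) a(2) val_ge_commute by (simp add: vtx_eq_iff)
    with cls[OF a(1)] \<alpha> show "x \<in> {homothety_class \<iota> ((\<lambda>z. u_prod \<iota> p \<pi> d n \<alpha> * z) `
        ring_O v \<iota> p \<pi> (int n)) | \<alpha>. \<alpha> \<in> index_I R d n}"
      by blast
  qed
qed

lemma descendants_eq:
  "{x \<in> bt_vertices v \<iota>. (parent ^^ d) x = vtx 0 (int n - int d)} =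
   {vtx a (int n) | a. val_ge v a (int n - int d)}"
proof -
  have "(parent ^^ d) (vtx a k) = vtx 0 (int n - int d) \<longleftrightarrow>
      k = int n \<and> val_ge v a (int n - int d)" for a k
    by (auto simp: funpow_parent_vtx vtx_eq_iff)
  then show ?thesis unfolding bt_vertices_eq by (smt (verit) Collect_cong mem_Collect_eq)
qed

end

theorem theorem5p18:
  fixes v :: "'k::field_char_0 \<Rightarrow> int" and w :: "'l::field \<Rightarrow> int" and \<iota> :: "'k \<Rightarrow> 'l"
    and p \<tau> \<delta> :: 'k and \<pi> :: 'l and R :: "'k set" and n d :: nat
  assumes "local_field v" and "uniformizer v p"
    and "ramified_quadratic v w \<iota>" and "uniformizer w \<pi>"
    and "minimal_poly \<iota> \<pi> [:\<delta>, - \<tau>, 1:]"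
    and "val_ge v \<tau> 1" and "\<delta> \<noteq> 0" and "v \<delta> = 1"
    and "residue_reps v p R"
    and "1 \<le> n" and "1 \<le> d" and "d \<le> n"
  shows "{homothety_class \<iota> ((\<lambda>z. u_prod \<iota> p \<pi> d n \<alpha> * z) ` ring_O v \<iota> p \<pi> (int n)) | \<alpha>.
            \<alpha> \<in> index_I R d n} =
         {x \<in> verts (bt_tree v \<iota> p).
            graph_dist (bt_tree v \<iota> p) x
              (homothety_class \<iota> (ring_O v \<iota> p \<pi> (int n - int d))) = ereal (real d) \<and>
            homothety_class \<iota> (ring_O v \<iota> p \<pi> (int n - int d - 1)) \<notin>
              geodesic_verts (bt_tree v \<iota> p) x
                (homothety_class \<iota> (ring_O v \<iota> p \<pi> (int n - int d)))}"
proof -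
  interpret local_field v by fact
  interpret ext: ramified_quadratic v w \<iota> by fact
  interpret quadratic_extension v \<iota> p \<tau> \<delta> \<pi>
    by unfold_locales (use assms ext.degree_two in \<open>auto simp: val_ge_def\<close>)
  interpret tree: end_rooted_tree "bt_tree v \<iota> p" parent height
    by (rule end_rooted_tree_bt_tree)
  have y: "vtx 0 (int n - int d) \<in> verts (bt_tree v \<iota> p)"
    by (auto simp: bt_tree_def bt_vertices_eq)
  show ?thesis
    using tree.descendants_eq_geodesics_avoiding_parent[OF y, of d] descendants_eq[of d n]
      orbit_eq_descendants[OF \<open>residue_reps v p R\<close> \<open>d \<le> n\<close>]
    by (simp add: ring_O_eq homothety_class_lat bt_tree_def)
qed

end
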